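(* Let $k, m \ge 2$, let $C, A_1, \ldots, A_k, B_1, \ldots, B_m \in \mathbb{N}$, let $A_* = \sum_{i=1}^k A_i$ and $B_* = \sum_{i=1}^m B_i$, and assume $A_* \ge B_*$. Let $n = 1 + C + A_* + B_*$ be the number of vertices of the double starlike tree $\mathrm{DS}(C; A_1, \ldots, A_k; B_1, \ldots, B_m)$. Furthermore, let $$\alpha_{ij} = (n - 1 - A_i - A_j)(A_j - A_i) \qquad (1 \le i, j \le k),$$ $$\beta_{ij} = (n - 1 - B_i - B_j)(B_j - B_i) \qquad (1 \le i, j \le m),$$ $$\gamma_{i} = (n - 1 - A_i - A_* )(A_* - A_i) \qquad (1 \le i \le k),$$ $$\delta_{ij} = (n - 1 - A_i - B_j)(B_j - A_i) + C(A_* - B_* ) \qquad (1 \le i \le k,\ 1 \le j \le m).$$ The tree $\mathrm{DS}(C; A_1, \ldots, A_k; B_1, \ldots, B_m)$ is transmission irregular if and only if all of the following conditions hold: (i) the values $A_1, \ldots, A_k$ are mutually distinct and the values $B_1, \ldots, B_m$ are also mutually distinct; (ii) $A_i < \frac{n}{2}$ for each $1 \le i \le k$, $B_i < \frac{n}{2}$ for each $1 \le i \le m$, and $1 + A_* > \frac{n}{2}$; (iii) for all $1 \le i < j \le k$, the number $\alpha_{ij}$ does not have a positive divisor $p \in \mathbb{N}$, $p > \sqrt{|\alpha_{ij}|}$, such that all of the following are satisfied: (a) $p$ and $\frac{\alpha_{ij}}{p}$ are of the same parity if and only if $2 \nmid n$; (b) $g(\alpha_{ij}, n + 1 - 2A_i)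 \le p \le g(\alpha_{ij}, n-1)$; (c) $g(\alpha_{ji}, n + 1 - 2A_j) \le p \le g(\alpha_{ji}, n-1)$; (iv) for all $1 \le i < j \le m$, the number $\beta_{ij}$ does not have a positive divisor $p \in \mathbb{N}$, $p > \sqrt{|\beta_{ij}|}$, such that all of the following are satisfied: (a) $p$ and $\frac{\beta_{ij}}{p}$ are of the same parity if and only if $2 \nmid n$; (b) $g(\beta_{ij}, n + 1 - 2B_i) \le p \le g(\beta_{ij}, n-1)$; (c) $g(\beta_{ji}, n + 1 - 2B_j) \le p \le g(\beta_{ji}, n-1)$; (v) for all $1 \le i \le k$, the number $\gamma_{i}$ does not have a positive divisor $p \in \mathbb{N}$, $p > \sqrt{|\gamma_{i}|}$, such that all of the following are satisfied: (a) $p$ and $\frac{\gamma_{i}}{p}$ are of the same parity if and only if $2 \nmid n$; (b) $g(\gamma_{i}, n + 1 - 2A_i) \le p \le g(\gamma_{i}, n-1)$; (c) $g(-\gamma_{i}, 2A_* - n + 3) \le p \le g(-\gamma_{i}, 2A_* + 2C - n + 1)$; (vi) for all $1 \le i \le k$, $1 \le j \le m$, the number $\delta_{ij}$ does not have a positive divisor $p \in \mathbb{N}$, $p > \sqrt{|\delta_{ij}|}$, such that all of the following are satisfied: (a) $p$ and $\frac{\delta_{ij}}{p}$ are of the same parity if and only if $2 \nmid n$; (b) $g(\delta_{ij}, n + 1 - 2A_i) \le p \le g(\delta_{ij}, n-1)$; (c) $g(-\delta_{ij}, n + 1 - 2B_j) \le p \le g(-\delta_{ij}, n-1)$.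
   Context: $\mathbb{N}$ denotes the positive integers. For a simple connected graph $G$, the transmission of a vertex $u$ is $\mathrm{Tr}_G(u) = \sum_{v \in V(G)} d_G(u,v)$, where $d_G$ is the graph distance. $G$ is transmission irregular (TI) if all its vertices have mutually distinct transmissions. A tree is double starlike if it contains exactly two vertices $u$ and $v$ of degree greater than two. $\mathrm{DS}(C; A_1, \ldots, A_k; B_1, \ldots, B_m)$ (with $k, m \ge 2$ and $C, A_i, B_i \in \mathbb{N}$) denotes the double starlike tree in which $u$ has degree $k+1$, $v$ has degree $m+1$, $d(u,v) = C$, the $k$ pendent paths starting at $u$ have lengths (numbers of edges) $A_1, \ldots, A_k$, and the $m$ pendent paths starting at $v$ have lengths $B_1, \ldots, B_m$. The function $g \colon \mathbb{R} \times (0, +\infty) \to \overline{\mathbb{R}}$ is defined by $g(C_1, C_2) = \frac{1}{2}\left(C_2 + \sqrt{C_2^2 - 4C_1}\right)$ if $C_2^2 - 4C_1 \ge 0$, and $g(C_1, C_2) = -\infty$ if $C_2^2 - 4C_1 < 0$. (When condition (ii) holds, all second arguments of $g$ appearing in (iii)–(vi) are positive.) *)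

theory Defs
  imports "Graph_Theory.Graph_Theory"
begin

section \<open>Transmissions\<close>

text \<open>Undirected graphs are symmetric digraphs (locale \<^locale>\<open>graph\<close>). With unit arc
  weights, the shortest-path weight of \<open>Graph_Theory\<close> is the graph distance, as a value in
  \<^typ>\<open>ereal\<close> that is infinite between different components.\<close>

definition gdist :: "('a, 'b) pre_digraph \<Rightarrow> 'a \<Rightarrow> 'a \<Rightarrow> ereal" where
  "gdist G x y = wf_digraph.\<mu> G (\<lambda>_. 1) x y"

definition transmission :: "('a, 'b) pre_digraph \<Rightarrow> 'a \<Rightarrow> ereal" where
  "transmission G x = (\<Sum>y\<in>verts G. gdist G x y)"

definition transmission_irregular :: "('a, 'b) pre_digraph \<Rightarrow> bool" where
  "transmission_irregular G \<longleftrightarrow>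
     graph G \<and> Digraph_Component.connected G \<and> inj_on (transmission G) (verts G)"


section \<open>Double starlike trees\<close>

text \<open>\<open>Spine 0, \<dots>, Spine C\<close> is the path between the two branching vertices \<open>u = Spine 0\<close> and
  \<open>v = Spine C\<close>. \<open>Arm_u i s\<close> is the vertex at distance \<open>s \<ge> 1\<close> from \<open>u\<close> on the \<open>i\<close>-th pendent
  path starting at \<open>u\<close>, and likewise \<open>Arm_v\<close> for \<open>v\<close>.\<close>

datatype ds_vertex = Spine nat | Arm_u nat nat | Arm_v nat nat

definition ds_verts ::
  "nat \<Rightarrow> nat \<Rightarrow> (nat \<Rightarrow> nat) \<Rightarrow> nat \<Rightarrow> (nat \<Rightarrow> nat) \<Rightarrow> ds_vertex set" where
  "ds_verts C k A m B =
     {Spine t |t. t \<le> C}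
     \<union> {Arm_u i s |i s. i \<in> {1..k} \<and> 1 \<le> s \<and> s \<le> A i}
     \<union> {Arm_v j s |j s. j \<in> {1..m} \<and> 1 \<le> s \<and> s \<le> B j}"

text \<open>Each edge is listed in one direction only; \<open>DS\<close> adds the reversed arcs.\<close>

definition ds_edges ::
  "nat \<Rightarrow> nat \<Rightarrow> (nat \<Rightarrow> nat) \<Rightarrow> nat \<Rightarrow> (nat \<Rightarrow> nat) \<Rightarrow> (ds_vertex \<times> ds_vertex) set" where
  "ds_edges C k A m B =
     {(Spine t, Spine (Suc t)) |t. t < C}
     \<union> {(Spine 0, Arm_u i 1) |i. i \<in> {1..k}}
     \<union> {(Arm_u i s, Arm_u i (Suc s)) |i s. i \<in> {1..k} \<and> 1 \<le> s \<and> s < A i}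
     \<union> {(Spine C, Arm_v j 1) |j. j \<in> {1..m}}
     \<union> {(Arm_v j s, Arm_v j (Suc s)) |j s. j \<in> {1..m} \<and> 1 \<le> s \<and> s < B j}"

definition DS ::
  "nat \<Rightarrow> nat \<Rightarrow> (nat \<Rightarrow> nat) \<Rightarrow> nat \<Rightarrow> (nat \<Rightarrow> nat) \<Rightarrow> ds_vertex pair_pre_digraph" where
  "DS C k A m B =
     \<lparr> pverts = ds_verts C k A m B,
       parcs = ds_edges C k A m B \<union> (ds_edges C k A m B)\<inverse> \<rparr>"

lemma ds_verts_Sigma:
  "ds_verts C k A m B =
     Spine ` {..C} \<union> (\<lambda>(i, s). Arm_u i s) ` (SIGMA i:{1..k}. {1..A i})
     \<union> (\<lambda>(j, s). Arm_v j s) ` (SIGMA j:{1..m}. {1..B j})"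
  unfolding ds_verts_def by (auto simp: image_iff)

lemma finite_ds_verts: "finite (ds_verts C k A m B)"
  unfolding ds_verts_Sigma by auto

lemma card_verts_DS:
  "card (pverts (DS C k A m B)) = 1 + C + (\<Sum>i=1..k. A i) + (\<Sum>j=1..m. B j)"
proof -
  let ?S = "Spine ` {..C}"
  let ?U = "(\<lambda>(i, s). Arm_u i s) ` (SIGMA i:{1..k}. {1..A i})"
  let ?V = "(\<lambda>(j, s). Arm_v j s) ` (SIGMA j:{1..m}. {1..B j})"
  have "card ?S = 1 + C"
    by (subst card_image) (auto simp: inj_on_def)
  moreover have "card ?U = (\<Sum>i=1..k. A i)"
    by (subst card_image) (auto simp: inj_on_def)
  moreover have "card ?V = (\<Sum>j=1..m. B j)"
    by (subst card_image) (auto simp: inj_on_def)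
  moreover have "card (?S \<union> ?U \<union> ?V) = card (?S \<union> ?U) + card ?V"
    by (rule card_Un_disjoint) auto
  moreover have "card (?S \<union> ?U) = card ?S + card ?U"
    by (rule card_Un_disjoint) auto
  ultimately show ?thesis by (simp add: DS_def ds_verts_Sigma)
qed

lemma graph_DS:
  assumes "\<And>i. i \<in> {1..k} \<Longrightarrow> 1 \<le> A i" "\<And>j. j \<in> {1..m} \<Longrightarrow> 1 \<le> B j"
  shows "graph (DS C k A m B)"
proof -
  let ?V = "ds_verts C k A m B" and ?E = "ds_edges C k A m B"
  have E: "?E \<subseteq> ?V \<times> ?V"
    using assms unfolding ds_edges_def ds_verts_def by fastforce
  have "finite ?E"
    using finite_subset[OF E] finite_ds_verts by blast
  moreover have "(x, x) \<notin> ?E" for x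
    by (auto simp: ds_edges_def)
  ultimately have "pair_graph (DS C k A m B)"
    using E finite_ds_verts[of C k A m B]
    by unfold_locales (auto simp: DS_def symmetric_def sym_def)
  then show ?thesis by (rule pair_graph.pair_graphD_graph)
qed

lemma connected_DS:
  assumes "\<And>i. i \<in> {1..k} \<Longrightarrow> 1 \<le> A i" "\<And>j. j \<in> {1..m} \<Longrightarrow> 1 \<le> B j"
  shows "Digraph_Component.connected (DS C k A m B)"
proof -
  let ?G = "with_proj (DS C k A m B)"
  interpret graph ?G by (rule graph_DS) (use assms in auto)
  have arc: "x \<rightarrow>\<^bsub>?G\<^esub> y" if "(x, y) \<in> ds_edges C k A m B" for x y
    using that by (simp add: DS_def)
  have v: "verts ?G = ds_verts C k A m B"
    by (simp add: DS_def)
  have S: "Spine 0 \<rightarrow>\<^sup>*\<^bsub>?G\<^esub> Spine t" if "t \<le> C" for t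
    using that
  proof (induction t)
    case 0
    show ?case by (rule reachable_refl) (simp add: DS_def ds_verts_def)
  next
    case (Suc t)
    then have "Spine t \<rightarrow>\<^bsub>?G\<^esub> Spine (Suc t)"
      by (intro arc) (auto simp: ds_edges_def)
    with Suc show ?case by (meson Suc_leD reachable_adj_trans)
  qed
  have U: "Spine 0 \<rightarrow>\<^sup>*\<^bsub>?G\<^esub> Arm_u i (Suc s)" if "i \<in> {1..k}" "Suc s \<le> A i" for i s
    using that
  proof (induction s)
    case 0
    then have "Spine 0 \<rightarrow>\<^bsub>?G\<^esub> Arm_u i 1"
      by (intro arc) (auto simp: ds_edges_def)
    with S[of 0] show ?case by (metis One_nat_def reachable_adj_trans zero_le)
  next
    case (Suc s)
    then have "Arm_u i (Suc s) \<rightarrow>\<^bsub>?G\<^esub> Arm_u i (Suc (Suc s))"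
      by (intro arc) (auto simp: ds_edges_def)
    with Suc show ?case by (meson Suc_leD reachable_adj_trans)
  qed
  have V: "Spine 0 \<rightarrow>\<^sup>*\<^bsub>?G\<^esub> Arm_v j (Suc s)" if "j \<in> {1..m}" "Suc s \<le> B j" for j s
    using that
  proof (induction s)
    case 0
    then have "Spine C \<rightarrow>\<^bsub>?G\<^esub> Arm_v j 1"
      by (intro arc) (auto simp: ds_edges_def)
    with S[of C] show ?case by (metis One_nat_def reachable_adj_trans order_refl)
  next
    case (Suc s)
    then have "Arm_v j (Suc s) \<rightarrow>\<^bsub>?G\<^esub> Arm_v j (Suc (Suc s))"
      by (intro arc) (auto simp: ds_edges_def)
    with Suc show ?case by (meson Suc_leD reachable_adj_trans)
  qed
  have all: "Spine 0 \<rightarrow>\<^sup>*\<^bsub>?G\<^esub> x" if "x \<in> verts ?G" for x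
  proof -
    from that have x: "x \<in> ds_verts C k A m B" unfolding v .
    show ?thesis
    proof (cases x)
      case (Spine t)
      with x S show ?thesis by (auto simp: ds_verts_def)
    next
      case (Arm_u i s)
      with x U[of i "s - 1"] show ?thesis by (auto simp: ds_verts_def)
    next
      case (Arm_v j s)
      with x V[of j "s - 1"] show ?thesis by (auto simp: ds_verts_def)
    qed
  qed
  have "strongly_connected ?G"
    unfolding strongly_connected_def
    using all symmetric_reachable[OF sym_arcs] reachable_trans
    by (metis empty_iff reachable_in_vertsE reachable_refl S zero_le)
  then show ?thesis
    unfolding Digraph_Component.connected_def strongly_connected_def
    by (auto intro: reachable_mk_symmetricI)
qed

lemma out_degree_DS_u:
  assumes "1 \<le> C"
  shows "out_degree (DS C k A m B) (Spine 0) = k + 1"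
proof -
  have "out_arcs (DS C k A m B) (Spine 0) =
      insert (Spine 0, Spine 1) ((\<lambda>i. (Spine 0, Arm_u i 1)) ` {1..k})"
    using assms by (auto simp: out_arcs_def DS_def ds_edges_def)
  moreover have "card \<dots> = Suc (card ((\<lambda>i. (Spine 0, Arm_u i 1)) ` {1..k}))"
    by (rule card_insert_disjoint) auto
  moreover have "card ((\<lambda>i. (Spine 0, Arm_u i 1)) ` {1..k}) = k"
    by (subst card_image) (auto simp: inj_on_def)
  ultimately show ?thesis by (simp add: out_degree_def)
qed

lemma out_degree_DS_v:
  assumes "1 \<le> C"
  shows "out_degree (DS C k A m B) (Spine C) = m + 1"
proof -
  have "out_arcs (DS C k A m B) (Spine C) =
      insert (Spine C, Spine (C - 1)) ((\<lambda>j. (Spine C, Arm_v j 1)) ` {1..m})"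
    using assms by (auto simp: out_arcs_def DS_def ds_edges_def)
  moreover have "card \<dots> = Suc (card ((\<lambda>j. (Spine C, Arm_v j 1)) ` {1..m}))"
    by (rule card_insert_disjoint) auto
  moreover have "card ((\<lambda>j. (Spine C, Arm_v j 1)) ` {1..m}) = m"
    by (subst card_image) (auto simp: inj_on_def)
  ultimately show ?thesis by (simp add: out_degree_def)
qed


section \<open>The bounding function\<close>

text \<open>The intended domain of the second argument is the positive reals.\<close>

definition g_bound :: "real \<Rightarrow> real \<Rightarrow> ereal" where
  "g_bound C1 C2 =
     (if C2\<^sup>2 - 4 * C1 \<ge> 0 then ereal (1/2 * (C2 + sqrt (C2\<^sup>2 - 4 * C1))) else -\<infinity>)"

end

theory Submission
  imports Defs
begin

text \<open>
  Let \<open>xy\<close> be a bridge and \<open>S\<close> the side of \<open>x\<close>. Vertices of \<open>S\<close> are one step farther from \<open>y\<close> than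
  from \<open>x\<close>, the others one step nearer, so \<open>Tr y - Tr x = |S| - |V - S|\<close>
  (\<open>transmission_across_bridge\<close>). Every edge of a tree is a bridge, and along a path through
  vertices of degree two each step moves exactly one vertex to the side left behind. Hence the
  increments form an arithmetic progression with difference 2, and the transmission at distance \<open>s\<close>
  from the start of the path exceeds the one at the start by a quadratic \<open>s (s + a)\<close>. The slope \<open>a\<close>
  is \<open>n - 1 - 2 A\<^sub>i\<close> or \<open>n - 1 - 2 B\<^sub>j\<close> on a pendent path and \<open>2 A\<^sub>* + 1 - n\<close> on the path from \<open>u\<close>
  to \<open>v\<close>, which makes \<open>Tr v - Tr u = C (A\<^sub>* - B\<^sub>*)\<close>. Transmission irregularity thus becomes
  injectivity of an explicit integer function (\<open>transmission_irregular_iff_inj_excess\<close>).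

  Condition (ii) says that all slopes are nonnegative. It is equivalent to injectivity on each single
  path: for a nonnegative slope the quadratic is strictly increasing, and for a negative slope \<open>a\<close>
  the vertex at distance \<open>-a\<close>, which still lies on the path, has the same transmission as the start.
  Condition (i) is forced, since two equally long arms at the same branching vertex carry the same
  transmissions. What remains are equalities between two different paths. An arm of \<open>v\<close> never
  competes with the path from \<open>u\<close> to \<open>v\<close>, because under (ii) transmissions increase towards \<open>v\<close>
  and increase further beyond it; the other four combinations are the subject of (iii) to (vi) (\<open>inj_excess_iff\<close>).

  An equality \<open>s (s + a) = c + s' (s' + b)\<close> turns, with \<open>X = 2 s + a\<close> and \<open>Y = 2 s' + b\<close>, into
  \<open>X\<^sup>2 - Y\<^sup>2 = 4 d\<close>, where \<open>d\<close> is the respective number \<open>\<alpha>\<close>, \<open>\<beta>\<close>, \<open>\<gamma>\<close> or \<open>\<delta>\<close>. So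
  \<open>p = (X + Y) / 2\<close> is a divisor of \<open>d\<close> with cofactor \<open>(X - Y) / 2\<close>, and \<open>X\<close>, \<open>Y\<close> are recovered as
  \<open>p + d / p\<close> and \<open>p - d / p\<close>; positivity of both is \<open>p > sqrt |d|\<close>, and integrality of \<open>s\<close> and \<open>s'\<close>
  is the parity condition (\<open>meets_iff_critical_divisor\<close>). Finally \<open>t + d / t\<close> increases for
  \<open>t > sqrt |d|\<close>; it reaches a value \<open>e > 0\<close> at the larger root of \<open>t\<^sup>2 - e t + d\<close>, which is
  \<open>g_bound d e\<close>, and always exceeds \<open>e\<close> if there is no real root. This converts the
  ranges of \<open>s\<close> and \<open>s'\<close> into the bounds on \<open>p\<close>
  (\<open>g_bound_le_iff\<close>, \<open>le_g_bound_iff\<close>).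
\<close>

section \<open>Transmissions across a bridge\<close>

context fin_digraph
begin

text \<open>A walk entering \<open>S\<close> passes through the only entrance \<open>x\<close>; the arc leading to \<open>x\<close> comes on top
  of the distance from \<open>x\<close>.\<close>

lemma gdist_cut_le_walk:
  assumes cut: "\<And>a b. a \<rightarrow>\<^bsub>G\<^esub> b \<Longrightarrow> a \<notin> S \<Longrightarrow> b \<in> S \<Longrightarrow> b = x"
    and walk: "awalk w p z" and "w \<notin> S" "z \<in> S"
  shows "gdist G x z + 1 \<le> ereal (awalk_cost (\<lambda>_. 1) p)"
  using walk \<open>w \<notin> S\<close>
proof (induction p arbitrary: w)
  case Nil
  then show ?case using \<open>z \<in> S\<close> by (simp add: awalk_Nil_iff)
next
  case (Cons e p)
  then have e: "e \<in> arcs G" "tail G e = w" and p: "awalk (head G e) p z"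
    by (auto simp: awalk_Cons_iff)
  have cost: "ereal (awalk_cost (\<lambda>_. 1) (e # p)) = ereal (awalk_cost (\<lambda>_. 1) p) + 1"
    by (simp add: add.commute one_ereal_def)
  show ?case
  proof (cases "head G e \<in> S")
    case True
    have "w \<rightarrow>\<^bsub>G\<^esub> head G e"
      using in_arcs_imp_in_arcs_ends[OF e(1)] e(2) by simp
    with True Cons.prems have "head G e = x" by (intro cut)
    with p have "gdist G x z \<le> ereal (awalk_cost (\<lambda>_. 1) p)"
      unfolding gdist_def by (intro min_cost_le_walk_cost) simp
    then show ?thesis unfolding cost by (rule add_right_mono)
  next
    case False
    have "gdist G x z + 1 \<le> ereal (awalk_cost (\<lambda>_. 1) p)"
      by (rule Cons.IH[OF p False])
    also have "\<dots> \<le> ereal (awalk_cost (\<lambda>_. 1) (e # p))"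
      unfolding awalk_cost_Cons by simp
    finally show ?thesis .
  qed
qed

lemma gdist_le_arc:
  assumes "y \<rightarrow>\<^bsub>G\<^esub> x"
  shows "gdist G y z \<le> gdist G x z + 1"
proof (cases "x \<rightarrow>\<^sup>* z")
  case True
  then obtain p where p: "apath x p z" "gdist G x z = awalk_cost (\<lambda>_. 1) p"
    unfolding gdist_def using min_cost_awalk[of x z "\<lambda>_. 1"] by auto
  obtain e where e: "e \<in> arcs G" "tail G e = y" "head G e = x"
    using assms by auto
  have "awalk y (e # p) z"
    using p e by (auto simp: awalk_Cons_iff apath_def)
  then have "gdist G y z \<le> awalk_cost (\<lambda>_. 1) (e # p)"
    unfolding gdist_def by (rule min_cost_le_walk_cost)
  with p show ?thesis by (simp add: add.commute one_ereal_def)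
next
  case False
  then show ?thesis by (simp add: gdist_def shortest_path_inf)
qed

lemma gdist_across_bridge:
  assumes "y \<rightarrow>\<^bsub>G\<^esub> x" "y \<notin> S" "z \<in> S"
    and cut: "\<And>a b. a \<rightarrow>\<^bsub>G\<^esub> b \<Longrightarrow> a \<notin> S \<Longrightarrow> b \<in> S \<Longrightarrow> b = x"
  shows "gdist G y z = gdist G x z + 1"
proof (rule antisym[OF gdist_le_arc[OF assms(1)]])
  show "gdist G x z + 1 \<le> gdist G y z"
    unfolding gdist_def[of G y] \<mu>_def
  proof (rule INF_greatest)
    fix p assume "p \<in> {p. awalk y p z}"
    then have "awalk y p z" by simp
    from gdist_cut_le_walk[OF cut this assms(2,3)]
    show "gdist G x z + 1 \<le> ereal (awalk_cost (\<lambda>_. 1) p)" .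
  qed
qed

end

text \<open>The equation is written with additions because differences of \<^typ>\<open>ereal\<close> values only behave
  well once the transmissions are known to be finite.\<close>

lemma (in graph) transmission_across_bridge:
  assumes "S \<subseteq> verts G" "x \<in> S" "y \<in> verts G - S" "x \<rightarrow>\<^bsub>G\<^esub> y"
    and cut: "\<And>a b. a \<rightarrow>\<^bsub>G\<^esub> b \<Longrightarrow> a \<in> S \<Longrightarrow> b \<notin> S \<Longrightarrow> a = x \<and> b = y"
  shows "transmission G y + ereal (card (verts G - S)) = transmission G x + ereal (card S)"
proof -
  have "y \<rightarrow>\<^bsub>G\<^esub> x"
    using assms(4) by (rule arcs_ends_symmetric[OF sym_arcs])
  have inward: "b = x" if "a \<rightarrow>\<^bsub>G\<^esub> b" "a \<notin> S" "b \<in> S" for a b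
    using cut[OF arcs_ends_symmetric[OF sym_arcs that(1)]] that(2,3) by blast
  have S: "gdist G y z = gdist G x z + 1" if "z \<in> S" for z
  proof (rule gdist_across_bridge[OF \<open>y \<rightarrow>\<^bsub>G\<^esub> x\<close> _ that inward])
    show "y \<notin> S" using assms(3) by simp
  qed
  have outward: "b = y" if "a \<rightarrow>\<^bsub>G\<^esub> b" "a \<notin> - S" "b \<in> - S" for a b
    using cut[OF that(1)] that(2,3) by blast
  have T: "gdist G x z = gdist G y z + 1" if "z \<in> verts G - S" for z
  proof (rule gdist_across_bridge[OF assms(4) _ _ outward])
    show "x \<notin> - S" "z \<in> - S" using that assms(2) by auto
  qed
  have split: "transmission G w = (\<Sum>z\<in>S. gdist G w z) + (\<Sum>z\<in>verts G - S. gdist G w z)" for w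
    unfolding transmission_def using assms(1) by (metis finite_verts sum.subset_diff add.commute)
  have ones: "(\<Sum>z\<in>X. 1) = ereal (card X)" for X :: "'a set"
    using sum_ereal[of "\<lambda>_. 1" X] by (simp add: one_ereal_def)
  have "transmission G y = (\<Sum>z\<in>S. gdist G x z) + ereal (card S) + (\<Sum>z\<in>verts G - S. gdist G y z)"
    unfolding split by (simp add: S sum.distrib ones)
  moreover have "transmission G x =
      (\<Sum>z\<in>S. gdist G x z) + ((\<Sum>z\<in>verts G - S. gdist G y z) + ereal (card (verts G - S)))"
    unfolding split by (simp add: T sum.distrib ones)
  ultimately show ?thesis by (simp add: ac_simps)
qed

lemma (in graph) transmission_finite:
  assumes "Digraph_Component.connected G" "x \<in> verts G"
  shows "\<bar>transmission G x\<bar> \<noteq> \<infinity>"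
proof -
  have "\<bar>gdist G x z\<bar> \<noteq> \<infinity>" if "z \<in> verts G" for z
  proof -
    have "x \<rightarrow>\<^sup>* z"
      using assms that reachable_mk_symmetric_eq[OF sym_arcs]
      by (simp add: Digraph_Component.connected_def strongly_connected_def)
    then show ?thesis
      using min_cost_awalk[of x z "\<lambda>_. 1"] by (auto simp: gdist_def)
  qed
  then show ?thesis
    unfolding transmission_def by (simp add: sum_Inf)
qed

section \<open>Transmissions in double starlike trees\<close>

text \<open>The gain in transmission after \<open>s\<close> steps along a path on which the first step gains \<open>a + 1\<close> and
  each further step gains 2 more than the one before.\<close>

definition climb :: "int \<Rightarrow> nat \<Rightarrow> int" where
  "climb a s = int s * (int s + a)"

lemma climb_0 [simp]: "climb a 0 = 0"
  by (simp add: climb_def)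

lemma climb_Suc: "climb a (Suc s) = climb a s + (2 * int s + 1 + a)"
  by (simp add: climb_def algebra_simps)

lemma climb_strict_mono:
  assumes "0 \<le> a" "s < t"
  shows "climb a s < climb a t"
  using assms unfolding climb_def by (intro mult_strict_mono') auto

locale double_starlike =
  fixes C k m :: nat and A B :: "nat \<Rightarrow> nat"
  assumes A_pos: "\<And>i. i \<in> {1..k} \<Longrightarrow> 1 \<le> A i"
    and B_pos: "\<And>j. j \<in> {1..m} \<Longrightarrow> 1 \<le> B j"
begin

abbreviation "T \<equiv> with_proj (DS C k A m B)"
abbreviation "V \<equiv> ds_verts C k A m B"

definition "A_tot = (\<Sum>i=1..k. A i)"
definition "B_tot = (\<Sum>j=1..m. B j)"
definition "order = 1 + C + A_tot + B_tot"

sublocale graph T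
  by (rule graph_DS) (use A_pos B_pos in auto)

lemma verts_T: "verts T = V"
  by (simp add: DS_def)

lemma card_V: "card V = order"
  using card_verts_DS[of C k A m B] by (simp add: DS_def order_def A_tot_def B_tot_def)

lemma arcs_T: "x \<rightarrow>\<^bsub>T\<^esub> y \<longleftrightarrow> (x, y) \<in> ds_edges C k A m B \<or> (y, x) \<in> ds_edges C k A m B"
  by (simp add: DS_def)

lemma A_le_A_tot: "i \<in> {1..k} \<Longrightarrow> A i \<le> A_tot"
  unfolding A_tot_def by (rule member_le_sum) auto

lemma B_le_B_tot: "j \<in> {1..m} \<Longrightarrow> B j \<le> B_tot"
  unfolding B_tot_def by (rule member_le_sum) auto

abbreviation "slope_u i \<equiv> int order - 1 - 2 * int (A i)"
abbreviation "slope_v j \<equiv> int order - 1 - 2 * int (B j)"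
abbreviation "slope_spine \<equiv> 2 * int A_tot + 1 - int order"

text \<open>The transmission relative to that of \<open>u\<close>. The constant on the arms of \<open>v\<close> is the excess of \<open>v\<close>
  itself.\<close>

primrec excess :: "ds_vertex \<Rightarrow> int" where
  "excess (Spine t) = climb slope_spine t"
| "excess (Arm_u i s) = climb (slope_u i) s"
| "excess (Arm_v j s) =
     int C * (int A_tot - int B_tot) + climb (slope_v j) s"

lemma excess_Spine_C: "excess (Spine C) = int C * (int A_tot - int B_tot)"
  by (simp add: climb_def order_def)

text \<open>One step of the telescoping: since \<open>|V - S| = n - |S|\<close>, the transmission changes by
  \<open>2 |S| - n\<close> when the bridge leading out of \<open>S\<close> is crossed. The number \<open>t0\<close> stands for \<open>Tr u\<close>.\<close>

lemma transmission_step: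
  assumes "S \<subseteq> V" "x \<in> S" "y \<in> V - S" "x \<rightarrow>\<^bsub>T\<^esub> y"
    and "\<And>a b. a \<rightarrow>\<^bsub>T\<^esub> b \<Longrightarrow> a \<in> S \<Longrightarrow> b \<notin> S \<Longrightarrow> a = x \<and> b = y"
    and x: "transmission T x = ereal (t0 + of_int (excess x))"
    and excess: "excess y + int order = excess x + 2 * int (card S)"
  shows "transmission T y = ereal (t0 + of_int (excess y))"
proof -
  have "card (V - S) + card S = order"
    using assms(1) card_V finite_ds_verts by (metis card_Diff_subset card_mono finite_subset le_add_diff_inverse2)
  then have ord: "int (card (V - S)) = int order - int (card S)" by linarith
  have "transmission T y + ereal (card (V - S)) = transmission T x + ereal (card S)"
    using transmission_across_bridge[of S x y] assms(1-5) unfolding verts_T by blast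
  then have "transmission T y + ereal (card (V - S)) = ereal (t0 + of_int (excess x) + card S)"
    using x by simp
  then have "transmission T y = ereal (t0 + of_int (excess x) + card S - card (V - S))"
    by (cases "transmission T y") auto
  also have "t0 + of_int (excess x) + card S - card (V - S) = t0 + of_int (excess x + int (card S) - int (card (V - S)))"
    by simp
  also have "excess x + int (card S) - int (card (V - S)) = excess y"
    using ord excess by linarith
  finally show ?thesis .
qed

text \<open>The side of an edge of a pendent path that contains the branching vertex is everything but the
  rest of that path.\<close>

lemma arm_tail_card:
  fixes arm :: "nat \<Rightarrow> ds_vertex" and l s :: nat
  assumes "inj arm" "arm ` {s<..l} \<subseteq> V" "s \<le> l"
  shows "int (card (V - arm ` {s<..l})) = int order - (int l - int s)"
proof -
  have "card (arm ` {s<..l}) = l - s"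
    using assms(1) by (subst card_image) (auto simp: inj_on_def inj_def)
  moreover have "card (V - arm ` {s<..l}) + card (arm ` {s<..l}) = order"
    using assms(2) card_V finite_ds_verts by (metis card_Diff_subset card_mono finite_subset le_add_diff_inverse2)
  ultimately show ?thesis using assms(3) by linarith
qed

lemma transmission_Spine:
  assumes "t \<le> C" "transmission T (Spine 0) = ereal t0"
  shows "transmission T (Spine t) = ereal (t0 + of_int (excess (Spine t)))"
  using assms(1)
proof (induction t)
  case 0
  then show ?case using assms(2) by simp
next
  case (Suc t)
  \<comment> \<open>The side of \<open>u\<close> is itself a tree of the same shape, with a spine of length \<open>t\<close> and no arms at its
    far end, so its size is already known.\<close>
  let ?S = "ds_verts t k A 0 B"
  have "card ?S = 1 + t + A_tot"
    using card_verts_DS[of t k A 0 B] by (simp add: DS_def A_tot_def)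
  show ?case
  proof (rule transmission_step[where S = ?S and x = "Spine t"])
    show "Spine t \<rightarrow>\<^bsub>T\<^esub> Spine (Suc t)"
      unfolding arcs_T using Suc by (auto simp: ds_edges_def)
    show "a = Spine t \<and> b = Spine (Suc t)" if "a \<rightarrow>\<^bsub>T\<^esub> b" "a \<in> ?S" "b \<notin> ?S" for a b
      using that Suc.prems A_pos unfolding arcs_T by (auto simp: ds_edges_def ds_verts_def)
    show "excess (Spine (Suc t)) + int order = excess (Spine t) + 2 * int (card ?S)"
      unfolding \<open>card ?S = _\<close> by (simp add: climb_Suc)
  qed (use Suc in \<open>auto simp: ds_verts_def\<close>)
qed

lemma transmission_Arm_u:
  assumes i: "i \<in> {1..k}" and "Suc s \<le> A i" "transmission T (Spine 0) = ereal t0"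
  shows "transmission T (Arm_u i (Suc s)) = ereal (t0 + of_int (excess (Arm_u i (Suc s))))"
  using assms(2)
proof (induction s)
  case 0
  let ?S = "V - Arm_u i ` {0<..A i}"
  have card: "int (card ?S) = int order - (int (A i) - int 0)"
    using i by (intro arm_tail_card) (auto simp: inj_def ds_verts_def)
  show ?case
  proof (rule transmission_step[where S = ?S and x = "Spine 0"])
    show "Spine 0 \<rightarrow>\<^bsub>T\<^esub> Arm_u i (Suc 0)"
      unfolding arcs_T using i by (auto simp: ds_edges_def)
    show "a = Spine 0 \<and> b = Arm_u i (Suc 0)" if "a \<rightarrow>\<^bsub>T\<^esub> b" "a \<in> ?S" "b \<notin> ?S" for a b
      using that A_pos B_pos unfolding arcs_T by (auto simp: ds_edges_def ds_verts_def)
    show "excess (Arm_u i (Suc 0)) + int order = excess (Spine 0) + 2 * int (card ?S)"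
      unfolding card by (simp add: climb_Suc)
  qed (use 0 i assms(3) in \<open>auto simp: ds_verts_def\<close>)
next
  case (Suc s)
  let ?S = "V - Arm_u i ` {Suc s<..A i}"
  have card: "int (card ?S) = int order - (int (A i) - int (Suc s))"
    using i Suc.prems by (intro arm_tail_card) (auto simp: inj_def ds_verts_def)
  show ?case
  proof (rule transmission_step[where S = ?S and x = "Arm_u i (Suc s)"])
    show "Arm_u i (Suc s) \<rightarrow>\<^bsub>T\<^esub> Arm_u i (Suc (Suc s))"
      unfolding arcs_T using i Suc.prems by (auto simp: ds_edges_def)
    show "a = Arm_u i (Suc s) \<and> b = Arm_u i (Suc (Suc s))"
      if "a \<rightarrow>\<^bsub>T\<^esub> b" "a \<in> ?S" "b \<notin> ?S" for a b
      using that A_pos B_pos unfolding arcs_T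
      by (auto simp: ds_edges_def ds_verts_def)
    show "excess (Arm_u i (Suc (Suc s))) + int order = excess (Arm_u i (Suc s)) + 2 * int (card ?S)"
      unfolding card by (simp add: climb_Suc)
  qed (use Suc i in \<open>auto simp: ds_verts_def\<close>)
qed

lemma transmission_Arm_v:
  assumes j: "j \<in> {1..m}" and "Suc s \<le> B j" "transmission T (Spine 0) = ereal t0"
  shows "transmission T (Arm_v j (Suc s)) = ereal (t0 + of_int (excess (Arm_v j (Suc s))))"
  using assms(2)
proof (induction s)
  case 0
  let ?S = "V - Arm_v j ` {0<..B j}"
  have card: "int (card ?S) = int order - (int (B j) - int 0)"
    using j by (intro arm_tail_card) (auto simp: inj_def ds_verts_def)
  show ?case
  proof (rule transmission_step[where S = ?S and x = "Spine C"])
    show "Spine C \<rightarrow>\<^bsub>T\<^esub> Arm_v j (Suc 0)"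
      unfolding arcs_T using j by (auto simp: ds_edges_def)
    show "a = Spine C \<and> b = Arm_v j (Suc 0)" if "a \<rightarrow>\<^bsub>T\<^esub> b" "a \<in> ?S" "b \<notin> ?S" for a b
      using that A_pos B_pos unfolding arcs_T by (auto simp: ds_edges_def ds_verts_def)
    show "excess (Arm_v j (Suc 0)) + int order = excess (Spine C) + 2 * int (card ?S)"
      unfolding card excess_Spine_C by (simp add: climb_Suc)
  qed (use 0 j transmission_Spine[OF order_refl assms(3)] in \<open>auto simp: ds_verts_def\<close>)
next
  case (Suc s)
  let ?S = "V - Arm_v j ` {Suc s<..B j}"
  have card: "int (card ?S) = int order - (int (B j) - int (Suc s))"
    using j Suc.prems by (intro arm_tail_card) (auto simp: inj_def ds_verts_def)
  show ?case
  proof (rule transmission_step[where S = ?S and x = "Arm_v j (Suc s)"])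
    show "Arm_v j (Suc s) \<rightarrow>\<^bsub>T\<^esub> Arm_v j (Suc (Suc s))"
      unfolding arcs_T using j Suc.prems by (auto simp: ds_edges_def)
    show "a = Arm_v j (Suc s) \<and> b = Arm_v j (Suc (Suc s))"
      if "a \<rightarrow>\<^bsub>T\<^esub> b" "a \<in> ?S" "b \<notin> ?S" for a b
      using that A_pos B_pos unfolding arcs_T
      by (auto simp: ds_edges_def ds_verts_def)
    show "excess (Arm_v j (Suc (Suc s))) + int order = excess (Arm_v j (Suc s)) + 2 * int (card ?S)"
      unfolding card by (simp add: climb_Suc)
  qed (use Suc j in \<open>auto simp: ds_verts_def\<close>)
qed

lemma transmission_eq_excess:
  assumes "transmission T (Spine 0) = ereal t0" "x \<in> V"
  shows "transmission T x = ereal (t0 + of_int (excess x))"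
proof (cases x)
  case (Spine t)
  with assms transmission_Spine show ?thesis by (auto simp: ds_verts_def)
next
  case (Arm_u i s)
  with assms transmission_Arm_u[of i "s - 1"] show ?thesis by (auto simp: ds_verts_def)
next
  case (Arm_v j s)
  with assms transmission_Arm_v[of j "s - 1"] show ?thesis by (auto simp: ds_verts_def)
qed

lemma transmission_irregular_iff_inj_excess:
  "transmission_irregular T \<longleftrightarrow> inj_on excess V"
proof -
  have con: "Digraph_Component.connected T"
    using connected_DS[of k A m B C] A_pos B_pos by blast
  have "Spine 0 \<in> verts T" unfolding verts_T by (simp add: ds_verts_def)
  with con have "\<bar>transmission T (Spine 0)\<bar> \<noteq> \<infinity>" by (rule transmission_finite)
  then obtain t0 where "transmission T (Spine 0) = ereal t0"
    by (cases "transmission T (Spine 0)") auto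
  then have "inj_on (transmission T) V \<longleftrightarrow> inj_on excess V"
    by (simp add: inj_on_def transmission_eq_excess)
  then show ?thesis
    using con graph_axioms unfolding transmission_irregular_def verts_T by blast
qed

end


section \<open>Collisions between paths\<close>

text \<open>Some inner or end vertex of a path of length \<open>S\<close> has the same transmission as one of a path of
  length \<open>S'\<close>, where the start of the second path exceeds that of the first by \<open>c\<close>. The starts
  themselves (distance 0) are excluded.\<close>

definition meets :: "int \<Rightarrow> nat \<Rightarrow> int \<Rightarrow> int \<Rightarrow> nat \<Rightarrow> bool" where
  "meets a S c b S' \<longleftrightarrow> (\<exists>s\<in>{1..S}. \<exists>s'\<in>{1..S'}. climb a s = c + climb b s')"

text \<open>With a negative slope the initial losses are made up exactly after \<open>-a\<close> steps.\<close>

lemma climb_root: "a < 0 \<Longrightarrow> climb a (nat (- a)) = 0"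
  by (simp add: climb_def)

lemma climb_pos: "0 \<le> a \<Longrightarrow> 1 \<le> s \<Longrightarrow> 0 < climb a s"
  using climb_strict_mono[of a 0 s] by simp

lemma climb_inj: "0 \<le> a \<Longrightarrow> climb a s = climb a t \<longleftrightarrow> s = t"
  using climb_strict_mono[of a s t] climb_strict_mono[of a t s]
  by (cases s t rule: linorder_cases) auto

text \<open>Nonnegativity of the slopes is forced, since a root of \<open>climb\<close> on a path is a coincidence with the
  start of the path. Such a root does lie on the path: on an arm because
  \<open>2 A\<^sub>i + 1 - n \<le> A\<^sub>i\<close>, and on the spine because \<open>n - 1 - 2 A\<^sub>* = C + B\<^sub>* - A\<^sub>* \<le> C\<close>, which is where
  \<open>A\<^sub>* \<ge> B\<^sub>*\<close> enters. Conversely, with nonnegative slopes \<open>u\<close> is the unique minimum and the arms of \<open>v\<close>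
  lie strictly above the whole spine, so only the listed pairs of paths can produce a coincidence.\<close>

lemma (in double_starlike) inj_excess_iff:
  assumes le: "B_tot \<le> A_tot"
  shows "inj_on excess V \<longleftrightarrow>
    (inj_on A {1..k} \<and> inj_on B {1..m}) \<and>
    ((\<forall>i\<in>{1..k}. 0 \<le> slope_u i) \<and> (\<forall>j\<in>{1..m}. 0 \<le> slope_v j) \<and> 0 \<le> slope_spine) \<and>
    (\<forall>i\<in>{1..k}. \<forall>j\<in>{1..k}. i < j \<longrightarrow> \<not> meets (slope_u i) (A i) 0 (slope_u j) (A j)) \<and>
    (\<forall>i\<in>{1..m}. \<forall>j\<in>{1..m}. i < j \<longrightarrow> \<not> meets (slope_v i) (B i) 0 (slope_v j) (B j)) \<and>
    (\<forall>i\<in>{1..k}. \<not> meets (slope_u i) (A i) 0 slope_spine C) \<and>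
    (\<forall>i\<in>{1..k}. \<forall>j\<in>{1..m}.
       \<not> meets (slope_u i) (A i) (int C * (int A_tot - int B_tot)) (slope_v j) (B j))"
  (is "_ \<longleftrightarrow> ?inj \<and> ?slopes \<and> ?UU \<and> ?VV \<and> ?UW \<and> ?UV")
proof
  have W: "Spine t \<in> V" if "t \<le> C" for t
    using that by (auto simp: ds_verts_def)
  have U: "Arm_u i s \<in> V" if "i \<in> {1..k}" "s \<in> {1..A i}" for i s
    using that by (auto simp: ds_verts_def)
  have V: "Arm_v j s \<in> V" if "j \<in> {1..m}" "s \<in> {1..B j}" for j s
    using that by (auto simp: ds_verts_def)
  assume "inj_on excess V"
  then have inj: "x = y" if "excess x = excess y" "x \<in> V" "y \<in> V" for x y
    using that by (rule inj_onD)
  have ?inj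
  proof (intro conjI inj_onI)
    fix i j assume ij: "i \<in> {1..k}" "j \<in> {1..k}" "A i = A j"
    have "Arm_u i 1 = Arm_u j 1"
    proof (rule inj)
      show "Arm_u i 1 \<in> V" "Arm_u j 1 \<in> V"
        using ij(1,2)[THEN A_pos] ij(1,2) by (auto intro: U)
      show "excess (Arm_u i 1) = excess (Arm_u j 1)" by (simp add: ij(3))
    qed
    then show "i = j" by simp
  next
    fix i j assume ij: "i \<in> {1..m}" "j \<in> {1..m}" "B i = B j"
    have "Arm_v i 1 = Arm_v j 1"
    proof (rule inj)
      show "Arm_v i 1 \<in> V" "Arm_v j 1 \<in> V"
        using ij(1,2)[THEN B_pos] ij(1,2) by (auto intro: V)
      show "excess (Arm_v i 1) = excess (Arm_v j 1)" by (simp add: ij(3))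
    qed
    then show "i = j" by simp
  qed
  moreover have ?slopes
  proof (intro conjI ballI)
    fix i assume i: "i \<in> {1..k}"
    show "0 \<le> slope_u i"
    proof (rule ccontr)
      assume neg: "\<not> 0 \<le> slope_u i"
      have "Arm_u i (nat (- slope_u i)) = Spine 0"
      proof (rule inj)
        show "Arm_u i (nat (- slope_u i)) \<in> V"
          using i neg A_le_A_tot[OF i] by (intro U) (auto simp: order_def)
      qed (use neg climb_root[of "slope_u i"] W in auto)
      then show False by simp
    qed
  next
    fix j assume j: "j \<in> {1..m}"
    show "0 \<le> slope_v j"
    proof (rule ccontr)
      assume neg: "\<not> 0 \<le> slope_v j"
      have "Arm_v j (nat (- slope_v j)) = Spine C"
      proof (rule inj)
        show "Arm_v j (nat (- slope_v j)) \<in> V"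
          using j neg B_le_B_tot[OF j] by (intro V) (auto simp: order_def)
        show "excess (Arm_v j (nat (- slope_v j))) = excess (Spine C)"
          unfolding excess_Spine_C using neg climb_root[of "slope_v j"] by simp
      qed (use W in auto)
      then show False by simp
    qed
  next
    show "0 \<le> slope_spine"
    proof (rule ccontr)
      assume neg: "\<not> 0 \<le> slope_spine"
      have "Spine (nat (- slope_spine)) = Spine 0"
      proof (rule inj)
        show "Spine (nat (- slope_spine)) \<in> V"
          using neg le by (intro W) (auto simp: order_def)
      qed (use neg climb_root[of "slope_spine"] W in auto)
      with neg show False by simp
    qed
  qed
  moreover have ?UU
    unfolding meets_def using inj[OF _ U U] by fastforce
  moreover have ?VV
    unfolding meets_def using inj[OF _ V V] by fastforce
  moreover have ?UW
    unfolding meets_def using inj[OF _ U W] by fastforce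
  moreover have ?UV
    unfolding meets_def using inj[OF _ U V] by fastforce
  ultimately show "?inj \<and> ?slopes \<and> ?UU \<and> ?VV \<and> ?UW \<and> ?UV" by blast
next
  assume R: "?inj \<and> ?slopes \<and> ?UU \<and> ?VV \<and> ?UW \<and> ?UV"
  then have su: "0 \<le> slope_u i" if "i \<in> {1..k}" for i using that by blast
  from R have sv: "0 \<le> slope_v j" if "j \<in> {1..m}" for j using that by blast
  from R have sw: "0 \<le> slope_spine" by blast
  have WW: "t = t'" if "excess (Spine t) = excess (Spine t')" for t t'
    using that climb_inj[OF sw] by simp
  have UW: False if "excess (Arm_u i s) = excess (Spine t)" "i \<in> {1..k}" "s \<in> {1..A i}" "t \<le> C" for i s t
  proof (cases "t = 0")
    case True
    then show False using that climb_pos[OF su[OF that(2)], of s] by simp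
  next
    case False
    then have "meets (slope_u i) (A i) 0 slope_spine C"
      unfolding meets_def using that by (intro bexI[of _ s] bexI[of _ t]) auto
    then show False using R that(2) by blast
  qed
  have VW: False if "excess (Arm_v j s) = excess (Spine t)" "j \<in> {1..m}" "s \<in> {1..B j}" "t \<le> C" for j s t
  proof -
    have "excess (Spine t) \<le> excess (Spine C)"
      using climb_strict_mono[OF sw, of t C] that(4) by (cases "t = C") auto
    also have "\<dots> < excess (Arm_v j s)"
      unfolding excess_Spine_C using climb_pos[OF sv[OF that(2)], of s] that(3) by simp
    finally show False using that(1) by simp
  qed
  have UV: False if "excess (Arm_u i s) = excess (Arm_v j s')"
    "i \<in> {1..k}" "s \<in> {1..A i}" "j \<in> {1..m}" "s' \<in> {1..B j}" for i s j s'
  proof -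
    have "meets (slope_u i) (A i) (int C * (int A_tot - int B_tot)) (slope_v j) (B j)"
      unfolding meets_def using that by (intro bexI[of _ s] bexI[of _ s']) auto
    then show False using R that(2,4) by blast
  qed
  have UU_less: False if "excess (Arm_u i s) = excess (Arm_u j s')"
    "i \<in> {1..k}" "s \<in> {1..A i}" "j \<in> {1..k}" "s' \<in> {1..A j}" "i < j" for i s j s'
  proof -
    have "meets (slope_u i) (A i) 0 (slope_u j) (A j)"
      unfolding meets_def using that by (intro bexI[of _ s] bexI[of _ s']) auto
    then show False using R that(2,4,6) by blast
  qed
  have UU: "i = j \<and> s = s'" if "excess (Arm_u i s) = excess (Arm_u j s')"
    "i \<in> {1..k}" "s \<in> {1..A i}" "j \<in> {1..k}" "s' \<in> {1..A j}" for i s j s'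
    using UU_less[OF that] UU_less[OF that(1)[symmetric] that(4,5,2,3)] that(1)
      climb_inj[OF su[OF that(2)]]
    by (cases i j rule: linorder_cases) auto
  have VV_less: False if "excess (Arm_v i s) = excess (Arm_v j s')"
    "i \<in> {1..m}" "s \<in> {1..B i}" "j \<in> {1..m}" "s' \<in> {1..B j}" "i < j" for i s j s'
  proof -
    have "meets (slope_v i) (B i) 0 (slope_v j) (B j)"
      unfolding meets_def using that by (intro bexI[of _ s] bexI[of _ s']) auto
    then show False using R that(2,4,6) by blast
  qed
  have VV: "i = j \<and> s = s'" if "excess (Arm_v i s) = excess (Arm_v j s')"
    "i \<in> {1..m}" "s \<in> {1..B i}" "j \<in> {1..m}" "s' \<in> {1..B j}" for i s j s'
    using VV_less[OF that] VV_less[OF that(1)[symmetric] that(4,5,2,3)] that(1)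
      climb_inj[OF sv[OF that(2)]]
    by (cases i j rule: linorder_cases) auto
  show "inj_on excess V"
  proof (rule inj_onI)
    fix x y assume x: "x \<in> V" and y: "y \<in> V" and eq: "excess x = excess y"
    have V_iff: "Spine t \<in> V \<longleftrightarrow> t \<le> C"
      "Arm_u i s \<in> V \<longleftrightarrow> i \<in> {1..k} \<and> s \<in> {1..A i}"
      "Arm_v j s \<in> V \<longleftrightarrow> j \<in> {1..m} \<and> s \<in> {1..B j}" for t i j s
      by (auto simp: ds_verts_def)
    show "x = y"
    proof (cases x)
      case (Spine t)
      with x y eq show ?thesis
        using WW UW[OF sym] VW[OF sym] by (cases y) (simp_all only: V_iff, blast+)
    next
      case (Arm_u i s)
      with x y eq show ?thesis
        using UU UW UV by (cases y) (simp_all only: V_iff, blast+)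
    next
      case (Arm_v j s)
      with x y eq show ?thesis
        using VV VW UV[OF sym] by (cases y) (simp_all only: V_iff, blast+)
    qed
  qed
qed
section \<open>Collisions as divisors\<close>

text \<open>In terms of \<open>e = p + c / p - d\<close> the discriminant satisfies \<open>(2 p - d)\<^sup>2 - D = 4 p e\<close>, so the sign
  of \<open>e\<close> decides on which side of the interval between the two roots of \<open>t\<^sup>2 - d t + c\<close> the number \<open>p\<close>
  lies. The hypothesis \<open>|c| < p\<^sup>2\<close> ensures that \<open>p\<close> exceeds the smaller root, so that only the larger
  root, the value of \<open>g_bound\<close>, matters.\<close>

lemma g_bound_iff:
  fixes c d p :: real
  assumes "0 < d" "0 < p" "\<bar>c\<bar> < p\<^sup>2"
  shows g_bound_le_iff: "g_bound c d \<le> ereal p \<longleftrightarrow> d \<le> p + c / p"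
    and le_g_bound_iff: "ereal p \<le> g_bound c d \<longleftrightarrow> p + c / p \<le> d"
proof -
  define D where "D = d\<^sup>2 - 4 * c"
  define e where "e = p + c / p - d"
  have eq: "(2 * p - d)\<^sup>2 - D = 4 * p * e"
    using assms(2) unfolding D_def e_def by (simp add: power2_eq_square field_simps)
  \<comment> \<open>No real roots: the default value of \<open>g_bound\<close> is minus infinity, in accordance with \<open>e > 0\<close>.\<close>
  have below: "0 < e" if "D < 0"
  proof -
    have "0 < 4 * p * e" using that eq by (smt (verit) zero_le_power2)
    with assms(2) show ?thesis by (simp add: zero_less_mult_iff)
  qed
  have pd: "\<bar>2 * p - d\<bar> \<le> sqrt D \<longleftrightarrow> e \<le> 0" "sqrt D \<le> \<bar>2 * p - d\<bar> \<longleftrightarrow> 0 \<le> e" if "0 \<le> D"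
  proof -
    have "\<bar>2 * p - d\<bar> \<le> sqrt D \<longleftrightarrow> 4 * p * e \<le> 0"
      unfolding eq[symmetric] using that by (simp add: real_le_rsqrt flip: abs_le_square_iff)
         (metis abs_ge_zero abs_of_nonneg real_sqrt_ge_zero real_sqrt_abs real_sqrt_le_iff)
    then show "\<bar>2 * p - d\<bar> \<le> sqrt D \<longleftrightarrow> e \<le> 0"
      using assms(2) by (simp add: mult_le_0_iff)
    have "sqrt D \<le> \<bar>2 * p - d\<bar> \<longleftrightarrow> 0 \<le> 4 * p * e"
      unfolding eq[symmetric] using that by (metis diff_ge_0_iff_ge real_sqrt_abs real_sqrt_le_iff)
    then show "sqrt D \<le> \<bar>2 * p - d\<bar> \<longleftrightarrow> 0 \<le> e"
      using assms(2) by (simp add: zero_le_mult_iff)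
  qed
  \<comment> \<open>Otherwise \<open>p\<close> is at most the smaller root and then \<open>2 p \<le> d \<le> p + c / p < 2 p\<close>.\<close>
  have above: "d - 2 * p < sqrt D" if "0 \<le> D"
  proof (rule ccontr)
    assume "\<not> d - 2 * p < sqrt D"
    then have "sqrt D \<le> d - 2 * p" by simp
    moreover have "0 \<le> sqrt D" using that by simp
    ultimately have "2 * p \<le> d" "sqrt D \<le> \<bar>2 * p - d\<bar>" by linarith+
    with pd(2)[OF that] have "0 \<le> e" by blast
    have "d \<le> p + c / p" using \<open>0 \<le> e\<close> by (simp add: e_def)
    moreover have "c / p < p" using assms by (simp add: divide_less_eq power2_eq_square)
    ultimately show False using \<open>2 * p \<le> d\<close> by linarith
  qed
  show "g_bound c d \<le> ereal p \<longleftrightarrow> d \<le> p + c / p"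
  proof (cases "0 \<le> D")
    case True
    have "g_bound c d \<le> ereal p \<longleftrightarrow> sqrt D \<le> 2 * p - d"
      using True by (auto simp: g_bound_def D_def)
    with above[OF True] pd(2)[OF True] show ?thesis by (auto simp: e_def)
  qed (use below in \<open>simp add: g_bound_def D_def e_def\<close>)
  show "ereal p \<le> g_bound c d \<longleftrightarrow> p + c / p \<le> d"
  proof (cases "0 \<le> D")
    case True
    have "ereal p \<le> g_bound c d \<longleftrightarrow> 2 * p - d \<le> sqrt D"
      using True by (auto simp: g_bound_def D_def)
    with above[OF True] pd(1)[OF True] show ?thesis by (auto simp: e_def)
  qed (use below in \<open>simp add: g_bound_def D_def e_def\<close>)
qed

text \<open>The common shape of the divisors forbidden in conditions (iii) to (vi). The interval from \<open>l\<close> to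
  \<open>u\<close> bounds \<open>p + d / p\<close>, and the one from \<open>l'\<close> to \<open>u'\<close> bounds \<open>p - d / p\<close>.\<close>

definition critical_divisor :: "nat \<Rightarrow> int \<Rightarrow> real \<Rightarrow> real \<Rightarrow> real \<Rightarrow> real \<Rightarrow> nat \<Rightarrow> bool" where
  "critical_divisor n d l u l' u' p \<longleftrightarrow>
     p > 0 \<and> int p dvd d \<and> real p > sqrt \<bar>real_of_int d\<bar> \<and>
     ((even (int p) \<longleftrightarrow> even (d div int p)) \<longleftrightarrow> \<not> 2 dvd n) \<and>
     g_bound d l \<le> ereal p \<and> ereal p \<le> g_bound d u \<and>
     g_bound (- d) l' \<le> ereal p \<and> ereal p \<le> g_bound (- d) u'"

text \<open>The same notion in integer arithmetic, through the cofactor \<open>q = d / p\<close>: the size condition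
  becomes \<open>|q| < p\<close>, and having equal parity becomes evenness of \<open>p + q\<close>.\<close>

lemma critical_divisor_iff:
  fixes l u l' u' :: int
  assumes "0 < l" "l \<le> u" "0 < l'" "l' \<le> u'"
  shows "critical_divisor n d l u l' u' p \<longleftrightarrow>
    (\<exists>q. 0 < p \<and> d = int p * q \<and> \<bar>q\<bar> < int p \<and> (even (int p + q) \<longleftrightarrow> odd n) \<and>
       l \<le> int p + q \<and> int p + q \<le> u \<and> l' \<le> int p - q \<and> int p - q \<le> u')"
proof (cases "0 < p \<and> int p dvd d")
  case False
  then show ?thesis by (auto simp: critical_divisor_def)
next
  case True
  then obtain q where p: "0 < p" and d: "d = int p * q" by (auto elim: dvdE)
  \<comment> \<open>The cofactor is unique, which eliminates the existential quantifier.\<close>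
  have q: "(\<exists>q'. 0 < p \<and> d = int p * q' \<and> P q') \<longleftrightarrow> P q" for P
    using p d by auto
  have "\<bar>real_of_int d\<bar> < (real p)\<^sup>2 \<longleftrightarrow> \<bar>real_of_int q\<bar> < real p"
    using p by (simp add: d abs_mult power2_eq_square)
  also have "\<dots> \<longleftrightarrow> \<bar>q\<bar> < int p" by linarith
  finally have square: "\<bar>real_of_int d\<bar> < (real p)\<^sup>2 \<longleftrightarrow> \<bar>q\<bar> < int p" .
  then have size: "sqrt \<bar>real_of_int d\<bar> < real p \<longleftrightarrow> \<bar>q\<bar> < int p"
    using p real_sqrt_less_iff[of "\<bar>real_of_int d\<bar>" "(real p)\<^sup>2"] by simp
  show ?thesis
  proof (cases "\<bar>q\<bar> < int p")
    case False
    then show ?thesis unfolding q using size by (simp add: critical_divisor_def)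
  next
    case True
    then have sq: "\<bar>real_of_int d\<bar> < (real p)\<^sup>2" "\<bar>- real_of_int d\<bar> < (real p)\<^sup>2"
      using square by auto
    have quot: "real_of_int d / real p = real_of_int q" "d div int p = q"
      using p d by auto
    have pos: "0 < real_of_int l" "0 < real_of_int u" "0 < real_of_int l'" "0 < real_of_int u'" "0 < real p"
      using assms p by auto
    show ?thesis
      unfolding q critical_divisor_def size of_int_minus
        g_bound_le_iff[OF pos(1,5) sq(1)] le_g_bound_iff[OF pos(2,5) sq(1)]
        g_bound_le_iff[OF pos(3,5) sq(2)] le_g_bound_iff[OF pos(4,5) sq(2)]
        quot minus_divide_left[symmetric]
      using True p d by auto
  qed
qed

text \<open>Completing the squares: \<open>X = 2 s + a\<close> and \<open>Y = 2 s' + b\<close> satisfy \<open>X\<^sup>2 - Y\<^sup>2 = 4 d\<close> exactly for the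
  coincidences, and \<open>p = (X + Y) / 2\<close>, \<open>q = (X - Y) / 2\<close> is an invertible change of variables. Both
  \<open>X\<close> and \<open>Y\<close> are positive because the slopes are nonnegative, whence \<open>|q| < p\<close>; they have the parity
  of \<open>a\<close> and \<open>b\<close>, which is that of \<open>n - 1\<close>.\<close>

lemma meets_iff_critical_divisor:
  fixes a b c d :: int
  assumes "0 \<le> a" "0 \<le> b" "1 \<le> S" "1 \<le> S'"
    and parity: "even a \<longleftrightarrow> odd n" "even b \<longleftrightarrow> odd n"
    and d: "4 * d = a\<^sup>2 - b\<^sup>2 + 4 * c"
  shows "meets a S c b S' \<longleftrightarrow>
    (\<exists>p. critical_divisor n d (of_int (a + 2)) (of_int (a + 2 * int S))
       (of_int (b + 2)) (of_int (b + 2 * int S')) p)"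
  (is "_ \<longleftrightarrow> ?R")
proof -
  have crit: "critical_divisor n d (of_int (a + 2)) (of_int (a + 2 * int S))
       (of_int (b + 2)) (of_int (b + 2 * int S')) p \<longleftrightarrow>
    (\<exists>q. 0 < p \<and> d = int p * q \<and> \<bar>q\<bar> < int p \<and> (even (int p + q) \<longleftrightarrow> odd n) \<and>
       a + 2 \<le> int p + q \<and> int p + q \<le> a + 2 * int S \<and>
       b + 2 \<le> int p - q \<and> int p - q \<le> b + 2 * int S')" for p
    by (rule critical_divisor_iff) (use assms in auto)
  have climb: "(2 * int s + a)\<^sup>2 = 4 * climb a s + a\<^sup>2" for s and a :: int
    by (simp add: climb_def power2_eq_square algebra_simps)
  show ?thesis
    unfolding meets_def
  proof
    assume "\<exists>s\<in>{1..S}. \<exists>s'\<in>{1..S'}. climb a s = c + climb b s'"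
    then obtain s s' where s: "1 \<le> s" "s \<le> S" and s': "1 \<le> s'" "s' \<le> S'"
      and eq: "climb a s = c + climb b s'" by auto
    define X Y where "X = 2 * int s + a" and "Y = 2 * int s' + b"
    have "even (X + Y)" using parity by (auto simp: X_def Y_def)
    then obtain P where P: "X + Y = 2 * P" by (elim evenE)
    define q where "q = X - P"
    have X: "X = P + q" and Y: "Y = P - q" using P by (auto simp: q_def)
    have "4 * d = X\<^sup>2 - Y\<^sup>2" unfolding X_def Y_def climb d using eq by simp
    also have "\<dots> = 4 * (P * q)" unfolding X Y by (simp add: power2_eq_square algebra_simps)
    finally have "d = P * q" by simp
    have bnd: "a + 2 \<le> X" "X \<le> a + 2 * int S" "b + 2 \<le> Y" "Y \<le> b + 2 * int S'"
      using s s' by (auto simp: X_def Y_def)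
    have "\<bar>q\<bar> < P" using bnd X Y assms(1,2) by linarith
    then obtain p where p: "P = int p" "0 < p"
      by (metis abs_ge_zero order.strict_trans1 zero_less_imp_eq_int)
    have "even X \<longleftrightarrow> odd n" using parity by (simp add: X_def)
    with p \<open>d = P * q\<close> \<open>\<bar>q\<bar> < P\<close> bnd show ?R
      unfolding crit X Y by blast
  next
    assume ?R
    then obtain p q where "d = int p * q" and par: "even (int p + q) \<longleftrightarrow> odd n"
      and bnd: "a + 2 \<le> int p + q" "int p + q \<le> a + 2 * int S"
        "b + 2 \<le> int p - q" "int p - q \<le> b + 2 * int S'"
      unfolding crit by blast
    have "even (int p + q - a)" using par parity by auto
    then obtain s where s: "int p + q - a = 2 * s" by (elim evenE)
    have "even (int p - q - b)" using par parity by auto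
    then obtain s' where s': "int p - q - b = 2 * s'" by (elim evenE)
    have r: "1 \<le> s" "s \<le> int S" "1 \<le> s'" "s' \<le> int S'" using bnd s s' by auto
    then obtain t t' where t: "s = int t" "s' = int t'" by (metis nonneg_int_cases order_trans zero_le_one)
    have "int p + q = 2 * int t + a" "int p - q = 2 * int t' + b" using s s' t by auto
    then have "4 * d = (2 * int t + a)\<^sup>2 - (2 * int t' + b)\<^sup>2"
      unfolding \<open>d = int p * q\<close> by (simp flip: \<open>int p + q = 2 * int t + a\<close> \<open>int p - q = 2 * int t' + b\<close>)
        (simp add: power2_eq_square algebra_simps)
    then have "climb a t = c + climb b t'" unfolding climb d by simp
    moreover have "t \<in> {1..S}" "t' \<in> {1..S'}" using r t by auto
    ultimately show "\<exists>s\<in>{1..S}. \<exists>s'\<in>{1..S'}. climb a s = c + climb b s'" by blast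
  qed
qed



section \<open>The characterisation\<close>

theorem theorem7:
  fixes k m C n A_star B_star :: nat
    and A B :: "nat \<Rightarrow> nat"
    and \<alpha> \<beta> \<delta> :: "nat \<Rightarrow> nat \<Rightarrow> int"
    and \<gamma> :: "nat \<Rightarrow> int"
  assumes "k \<ge> 2" and "m \<ge> 2" and "C \<ge> 1"
    and "\<And>i. i \<in> {1..k} \<Longrightarrow> A i \<ge> 1"
    and "\<And>j. j \<in> {1..m} \<Longrightarrow> B j \<ge> 1"
    and A_star: "A_star = (\<Sum>i=1..k. A i)"
    and B_star: "B_star = (\<Sum>i=1..m. B i)"
    and "A_star \<ge> B_star"
    and n: "n = 1 + C + A_star + B_star"
    and \<alpha>: "\<And>i j. \<alpha> i j = (int n - 1 - int (A i) - int (A j)) * (int (A j) - int (A i))"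
    and \<beta>: "\<And>i j. \<beta> i j = (int n - 1 - int (B i) - int (B j)) * (int (B j) - int (B i))"
    and \<gamma>: "\<And>i. \<gamma> i = (int n - 1 - int (A i) - int A_star) * (int A_star - int (A i))"
    and \<delta>: "\<And>i j. \<delta> i j = (int n - 1 - int (A i) - int (B j)) * (int (B j) - int (A i))
                            + int C * (int A_star - int B_star)"
  shows "transmission_irregular (with_proj (DS C k A m B)) \<longleftrightarrow>
    \<comment> \<open>(i)\<close>
    (inj_on A {1..k} \<and> inj_on B {1..m}) \<and>
    \<comment> \<open>(ii)\<close>
    ((\<forall>i\<in>{1..k}. real (A i) < real n / 2) \<and>
     (\<forall>i\<in>{1..m}. real (B i) < real n / 2) \<and>
     1 + real A_star > real n / 2) \<and>
    \<comment> \<open>(iii)\<close>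
    (\<forall>i\<in>{1..k}. \<forall>j\<in>{1..k}. i < j \<longrightarrow>
      \<not> (\<exists>p::nat. p > 0 \<and> int p dvd \<alpha> i j \<and> real p > sqrt \<bar>real_of_int (\<alpha> i j)\<bar> \<and>
           ((even (int p) \<longleftrightarrow> even (\<alpha> i j div int p)) \<longleftrightarrow> \<not> 2 dvd n) \<and>
           g_bound (\<alpha> i j) (real n + 1 - 2 * real (A i)) \<le> ereal p \<and>
           ereal p \<le> g_bound (\<alpha> i j) (real n - 1) \<and>
           g_bound (\<alpha> j i) (real n + 1 - 2 * real (A j)) \<le> ereal p \<and>
           ereal p \<le> g_bound (\<alpha> j i) (real n - 1))) \<and>
    \<comment> \<open>(iv)\<close>
    (\<forall>i\<in>{1..m}. \<forall>j\<in>{1..m}. i < j \<longrightarrow>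
      \<not> (\<exists>p::nat. p > 0 \<and> int p dvd \<beta> i j \<and> real p > sqrt \<bar>real_of_int (\<beta> i j)\<bar> \<and>
           ((even (int p) \<longleftrightarrow> even (\<beta> i j div int p)) \<longleftrightarrow> \<not> 2 dvd n) \<and>
           g_bound (\<beta> i j) (real n + 1 - 2 * real (B i)) \<le> ereal p \<and>
           ereal p \<le> g_bound (\<beta> i j) (real n - 1) \<and>
           g_bound (\<beta> j i) (real n + 1 - 2 * real (B j)) \<le> ereal p \<and>
           ereal p \<le> g_bound (\<beta> j i) (real n - 1))) \<and>
    \<comment> \<open>(v)\<close>
    (\<forall>i\<in>{1..k}.
      \<not> (\<exists>p::nat. p > 0 \<and> int p dvd \<gamma> i \<and> real p > sqrt \<bar>real_of_int (\<gamma> i)\<bar> \<and>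
           ((even (int p) \<longleftrightarrow> even (\<gamma> i div int p)) \<longleftrightarrow> \<not> 2 dvd n) \<and>
           g_bound (\<gamma> i) (real n + 1 - 2 * real (A i)) \<le> ereal p \<and>
           ereal p \<le> g_bound (\<gamma> i) (real n - 1) \<and>
           g_bound (- \<gamma> i) (2 * real A_star - real n + 3) \<le> ereal p \<and>
           ereal p \<le> g_bound (- \<gamma> i) (2 * real A_star + 2 * real C - real n + 1))) \<and>
    \<comment> \<open>(vi)\<close>
    (\<forall>i\<in>{1..k}. \<forall>j\<in>{1..m}.
      \<not> (\<exists>p::nat. p > 0 \<and> int p dvd \<delta> i j \<and> real p > sqrt \<bar>real_of_int (\<delta> i j)\<bar> \<and>
           ((even (int p) \<longleftrightarrow> even (\<delta> i j div int p)) \<longleftrightarrow> \<not> 2 dvd n) \<and>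
           g_bound (\<delta> i j) (real n + 1 - 2 * real (A i)) \<le> ereal p \<and>
           ereal p \<le> g_bound (\<delta> i j) (real n - 1) \<and>
           g_bound (- \<delta> i j) (real n + 1 - 2 * real (B j)) \<le> ereal p \<and>
           ereal p \<le> g_bound (- \<delta> i j) (real n - 1)))"
  proof -
  interpret D: double_starlike C k m A B
    by standard (use assms in auto)
  have tot: "D.A_tot = A_star" "D.B_tot = B_star" "D.order = n"
    by (simp_all add: D.A_tot_def D.B_tot_def D.order_def A_star B_star n)
  let ?a = "\<lambda>i. int n - 1 - 2 * int (A i)" and ?b = "\<lambda>j. int n - 1 - 2 * int (B j)"
    and ?c = "2 * int A_star + 1 - int n"
  have slope_iff: "(\<forall>i\<in>{1..k}. real (A i) < real n / 2) \<and>
     (\<forall>i\<in>{1..m}. real (B i) < real n / 2) \<and> 1 + real A_star > real n / 2 \<longleftrightarrow>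
     (\<forall>i\<in>{1..k}. 0 \<le> ?a i) \<and> (\<forall>j\<in>{1..m}. 0 \<le> ?b j) \<and> 0 \<le> ?c"
    by (intro conj_cong ball_cong) auto
  \<comment> \<open>A step count \<open>1 \<le> s \<le> A\<^sub>i\<close> means \<open>n + 1 - 2 A\<^sub>i \<le> 2 s + a \<le> n - 1\<close> for the slope \<open>a = n - 1 - 2 A\<^sub>i\<close>;
    these are the second arguments of \<open>g_bound\<close>.\<close>
  have uu: "meets (?a i) (A i) 0 (?a j) (A j) \<longleftrightarrow>
      (\<exists>p. critical_divisor n (\<alpha> i j) (real n + 1 - 2 * real (A i)) (real n - 1)
         (real n + 1 - 2 * real (A j)) (real n - 1) p)"
    if "0 \<le> ?a i" "0 \<le> ?a j" "i \<in> {1..k}" "j \<in> {1..k}" for i j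
  proof -
    have "4 * \<alpha> i j = (?a i)\<^sup>2 - (?a j)\<^sup>2 + 4 * 0"
      unfolding \<alpha> by (simp add: power2_eq_square algebra_simps)
    from meets_iff_critical_divisor[OF that(1,2) assms(4)[OF that(3)] assms(4)[OF that(4)] _ _ this]
    show ?thesis by (simp add: algebra_simps)
  qed
  have vv: "meets (?b i) (B i) 0 (?b j) (B j) \<longleftrightarrow>
      (\<exists>p. critical_divisor n (\<beta> i j) (real n + 1 - 2 * real (B i)) (real n - 1)
         (real n + 1 - 2 * real (B j)) (real n - 1) p)"
    if "0 \<le> ?b i" "0 \<le> ?b j" "i \<in> {1..m}" "j \<in> {1..m}" for i j
  proof -
    have "4 * \<beta> i j = (?b i)\<^sup>2 - (?b j)\<^sup>2 + 4 * 0"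
      unfolding \<beta> by (simp add: power2_eq_square algebra_simps)
    from meets_iff_critical_divisor[OF that(1,2) assms(5)[OF that(3)] assms(5)[OF that(4)] _ _ this]
    show ?thesis by (simp add: algebra_simps)
  qed
  have uw: "meets (?a i) (A i) 0 ?c C \<longleftrightarrow>
      (\<exists>p. critical_divisor n (\<gamma> i) (real n + 1 - 2 * real (A i)) (real n - 1)
         (2 * real A_star - real n + 3) (2 * real A_star + 2 * real C - real n + 1) p)"
    if "0 \<le> ?a i" "0 \<le> ?c" "i \<in> {1..k}" for i
  proof -
    have "4 * \<gamma> i = (?a i)\<^sup>2 - ?c\<^sup>2 + 4 * 0"
      unfolding \<gamma> by (simp add: power2_eq_square algebra_simps)
    from meets_iff_critical_divisor[OF that(1,2) assms(4)[OF that(3)] \<open>1 \<le> C\<close> _ _ this]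
    show ?thesis by (simp add: algebra_simps)
  qed
  have uv: "meets (?a i) (A i) (int C * (int A_star - int B_star)) (?b j) (B j) \<longleftrightarrow>
      (\<exists>p. critical_divisor n (\<delta> i j) (real n + 1 - 2 * real (A i)) (real n - 1)
         (real n + 1 - 2 * real (B j)) (real n - 1) p)"
    if "0 \<le> ?a i" "0 \<le> ?b j" "i \<in> {1..k}" "j \<in> {1..m}" for i j
  proof -
    have "4 * \<delta> i j = (?a i)\<^sup>2 - (?b j)\<^sup>2 + 4 * (int C * (int A_star - int B_star))"
      unfolding \<delta> by (simp add: power2_eq_square algebra_simps)
    from meets_iff_critical_divisor[OF that(1,2) assms(4)[OF that(3)] assms(5)[OF that(4)] _ _ this]
    show ?thesis by (simp add: algebra_simps)
  qed
  \<comment> \<open>For two arms at the same vertex the bounds on \<open>p - d / p\<close> are expressed with the indices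
    exchanged.\<close>
  have neg: "\<alpha> j i = - \<alpha> i j" "\<beta> j i = - \<beta> i j" for i j
    unfolding \<alpha> \<beta> by (simp_all add: algebra_simps)
  show ?thesis
    unfolding D.transmission_irregular_iff_inj_excess D.inj_excess_iff[unfolded tot, OF \<open>B_star \<le> A_star\<close>] slope_iff
  proof (intro conj_cong refl ball_cong imp_cong, goal_cases)
    case (1 i j)
    with uu[of i j] show ?case by (simp add: critical_divisor_def neg(1)[of j i])
  next
    case (2 i j)
    with vv[of i j] show ?case by (simp add: critical_divisor_def neg(2)[of j i])
  next
    case (3 i)
    with uw[of i] show ?case by (simp add: critical_divisor_def)
  next
    case (4 i j)
    with uv[of i j] show ?case by (simp add: critical_divisor_def)
  qed
qed

end
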